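(* As polynomials in $x$ and $y$ with coefficients in the group algebra of $\mathfrak{S}_n$, $$\phi(x)\psi(y)=\psi(xy).$$
   Context: $\mathfrak{S}_n$ is the symmetric group of bijections of $\{1,\ldots,n\}$ with composition $(\sigma\tau)(i)=\sigma(\tau(i))$. For $\pi\in\mathfrak{S}_n$, $\mathrm{des}(\pi)$ is the number of $i\in\{1,\ldots,n-1\}$ with $\pi(i)>\pi(i+1)$, and $\mathrm{cdes}(\pi)$ is the number of $i\in\{1,\ldots,n\}$ with $\pi(i)>\pi(i+1)$, where $\pi(n+1):=\pi(1)$. Define $$\phi(x)=\sum_{\pi\in\mathfrak{S}_n}\binom{x+n-1-\mathrm{des}(\pi)}{n}\pi,\qquad \psi(x)=\sum_{\pi\in\mathfrak{S}_n}\frac{x}{n}\binom{x+n-1-\mathrm{cdes}(\pi)}{n-1}\pi,$$ polynomials in $x$ with coefficients in $\mathbb{Q}[\mathfrak{S}_n]$, where $\binom{z}{m}=z(z-1)\cdots(z-m+1)/m!$. *)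

theory Defs
  imports
    "HOL-Algebra.Sym_Groups"
    "HOL-Algebra.UnivPoly"
    "HOL-Computational_Algebra.Polynomial"
begin

text \<open>
  HOL-Algebra polynomials (\<open>UP\<close>) are used for polynomials over the noncommutative
  group algebra, the type \<open>rat poly\<close> for the scalar polynomials in front of the
  permutations.
\<close>

hide_const (open) Polynomial.monom Polynomial.degree

section \<open>The rational group algebra of a finite group\<close>

text \<open>
  The function \<open>f\<close> stands for the formal sum of the \<open>f g \<cdot> g\<close> over \<open>g\<close> in \<open>G\<close>; it is
  required to vanish off the carrier. Only meant for finite \<open>G\<close>.
\<close>

definition group_algebra :: "('g, 'b) monoid_scheme \<Rightarrow> ('g \<Rightarrow> rat) ring" where
  "group_algebra G = \<lparr>
     carrier = {f. \<forall>g. g \<notin> carrier G \<longrightarrow> f g = 0},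
     mult = (\<lambda>f h x. \<Sum>(s, t) \<in> {(s, t). s \<in> carrier G \<and> t \<in> carrier G \<and> s \<otimes>\<^bsub>G\<^esub> t = x}. f s * h t),
     one = (\<lambda>x. if x = \<one>\<^bsub>G\<^esub> then 1 else 0),
     zero = (\<lambda>x. 0),
     add = (\<lambda>f h x. f x + h x)\<rparr>"

lemma group_algebra_simps:
  "carrier (group_algebra G) = {f. \<forall>g. g \<notin> carrier G \<longrightarrow> f g = 0}"
  "f \<otimes>\<^bsub>group_algebra G\<^esub> h =
     (\<lambda>x. \<Sum>(s, t) \<in> {(s, t). s \<in> carrier G \<and> t \<in> carrier G \<and> s \<otimes>\<^bsub>G\<^esub> t = x}. f s * h t)"
  "\<one>\<^bsub>group_algebra G\<^esub> = (\<lambda>x. if x = \<one>\<^bsub>G\<^esub> then 1 else 0)"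
  "\<zero>\<^bsub>group_algebra G\<^esub> = (\<lambda>x. 0)"
  "f \<oplus>\<^bsub>group_algebra G\<^esub> h = (\<lambda>x. f x + h x)"
  by (simp_all add: group_algebra_def)

lemma (in group) group_algebra_mult_apply:
  assumes "x \<in> carrier G"
  shows "(f \<otimes>\<^bsub>group_algebra G\<^esub> h) x = (\<Sum>s\<in>carrier G. f s * h (inv s \<otimes> x))"
proof -
  have "(\<Sum>s\<in>carrier G. f s * h (inv s \<otimes> x)) =
    (\<Sum>(s, t) \<in> {(s, t). s \<in> carrier G \<and> t \<in> carrier G \<and> s \<otimes> t = x}. f s * h t)"
    by (rule sum.reindex_bij_witness[where i = fst and j = "\<lambda>s. (s, inv s \<otimes> x)"])
      (use assms in \<open>auto simp: m_assoc[symmetric]\<close>)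
  then show ?thesis by (simp add: group_algebra_simps)
qed

lemma group_algebra_mult_outside:
  assumes "group G" "x \<notin> carrier G"
  shows "(f \<otimes>\<^bsub>group_algebra G\<^esub> h) x = 0"
proof -
  interpret group G by fact
  have "{(s, t). s \<in> carrier G \<and> t \<in> carrier G \<and> s \<otimes>\<^bsub>G\<^esub> t = x} = {}"
    using assms(2) by auto
  then show ?thesis by (simp only: group_algebra_simps sum.empty)
qed

lemma (in group) ring_group_algebra:
  assumes "finite (carrier G)"
  shows "ring (group_algebra G)"
proof -
  let ?A = "group_algebra G"
  note out = group_algebra_mult_outside[OF is_group]
  have mult_closed: "f \<otimes>\<^bsub>?A\<^esub> h \<in> carrier ?A" for f h
    using out by (auto simp: group_algebra_simps(1))
  have reindex: "(\<Sum>r\<in>carrier G. F r) = (\<Sum>r\<in>carrier G. F (s \<otimes> r))"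
    if "s \<in> carrier G" for F :: "_ \<Rightarrow> rat" and s
    by (rule sum.reindex_bij_witness[where i = "\<lambda>r. s \<otimes> r" and j = "\<lambda>r. inv s \<otimes> r"])
      (use that in \<open>auto simp: m_assoc[symmetric]\<close>)
  have assoc: "(f \<otimes>\<^bsub>?A\<^esub> g) \<otimes>\<^bsub>?A\<^esub> h = f \<otimes>\<^bsub>?A\<^esub> (g \<otimes>\<^bsub>?A\<^esub> h)" for f g h
  proof
    fix x
    show "((f \<otimes>\<^bsub>?A\<^esub> g) \<otimes>\<^bsub>?A\<^esub> h) x = (f \<otimes>\<^bsub>?A\<^esub> (g \<otimes>\<^bsub>?A\<^esub> h)) x"
    proof (cases "x \<in> carrier G")
      case True
      have "((f \<otimes>\<^bsub>?A\<^esub> g) \<otimes>\<^bsub>?A\<^esub> h) x =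
        (\<Sum>r\<in>carrier G. \<Sum>s\<in>carrier G. f s * g (inv s \<otimes> r) * h (inv r \<otimes> x))"
        using True by (simp add: group_algebra_mult_apply sum_distrib_right)
      also have "\<dots> = (\<Sum>s\<in>carrier G. \<Sum>r\<in>carrier G. f s * g (inv s \<otimes> r) * h (inv r \<otimes> x))"
        by (rule sum.swap)
      also have "\<dots> = (\<Sum>s\<in>carrier G. \<Sum>r\<in>carrier G.
                        f s * g (inv s \<otimes> (s \<otimes> r)) * h (inv (s \<otimes> r) \<otimes> x))"
        by (intro sum.cong[OF refl] reindex)
      also have "\<dots> = (\<Sum>s\<in>carrier G. \<Sum>r\<in>carrier G. f s * (g r * h (inv r \<otimes> (inv s \<otimes> x))))"
      proof (intro sum.cong refl)
        fix s r assume sr: "s \<in> carrier G" "r \<in> carrier G"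
        then have "inv s \<otimes> (s \<otimes> r) = r"
          by (simp add: m_assoc[symmetric])
        moreover have "inv (s \<otimes> r) \<otimes> x = inv r \<otimes> (inv s \<otimes> x)"
          using sr True by (simp add: inv_mult_group m_assoc)
        ultimately show "f s * g (inv s \<otimes> (s \<otimes> r)) * h (inv (s \<otimes> r) \<otimes> x) =
            f s * (g r * h (inv r \<otimes> (inv s \<otimes> x)))"
          by (simp add: mult.assoc)
      qed
      also have "\<dots> = (f \<otimes>\<^bsub>?A\<^esub> (g \<otimes>\<^bsub>?A\<^esub> h)) x"
        using True by (simp add: group_algebra_mult_apply sum_distrib_left)
      finally show ?thesis .
    qed (simp add: out)
  qed
  have one_left: "\<one>\<^bsub>?A\<^esub> \<otimes>\<^bsub>?A\<^esub> f = f" if "f \<in> carrier ?A" for f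
  proof
    fix x
    show "(\<one>\<^bsub>?A\<^esub> \<otimes>\<^bsub>?A\<^esub> f) x = f x"
    proof (cases "x \<in> carrier G")
      case True
      then have "(\<one>\<^bsub>?A\<^esub> \<otimes>\<^bsub>?A\<^esub> f) x = (\<Sum>s\<in>carrier G. if s = \<one> then f (inv s \<otimes> x) else 0)"
        by (auto simp: group_algebra_mult_apply group_algebra_simps(3) intro!: sum.cong)
      also have "\<dots> = f x" using True assms by simp
      finally show ?thesis .
    qed (use that in \<open>simp add: out group_algebra_simps(1)\<close>)
  qed
  have one_right: "f \<otimes>\<^bsub>?A\<^esub> \<one>\<^bsub>?A\<^esub> = f" if "f \<in> carrier ?A" for f
  proof
    fix x
    show "(f \<otimes>\<^bsub>?A\<^esub> \<one>\<^bsub>?A\<^esub>) x = f x"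
    proof (cases "x \<in> carrier G")
      case True
      have "inv s \<otimes> x = \<one> \<longleftrightarrow> s = x" if "s \<in> carrier G" for s
        using that True by (metis inv_equality inv_inv inv_closed l_inv)
      then have "(f \<otimes>\<^bsub>?A\<^esub> \<one>\<^bsub>?A\<^esub>) x = (\<Sum>s\<in>carrier G. if s = x then f s else 0)"
        using True
        by (auto simp: group_algebra_mult_apply group_algebra_simps(3) intro!: sum.cong)
      also have "\<dots> = f x" using True assms by simp
      finally show ?thesis .
    qed (use that in \<open>simp add: out group_algebra_simps(1)\<close>)
  qed
  have neg: "\<exists>g\<in>carrier ?A. g \<oplus>\<^bsub>?A\<^esub> f = \<zero>\<^bsub>?A\<^esub>" if "f \<in> carrier ?A" for f
    using that by (intro bexI[of _ "\<lambda>x. - f x"]) (auto simp: group_algebra_simps)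
  show ?thesis
  proof (rule ringI)
    show "abelian_group ?A"
      by (rule abelian_groupI) (use neg in \<open>auto simp: group_algebra_simps fun_eq_iff\<close>)
    show "monoid ?A"
      by (rule monoidI)
        (use mult_closed assoc one_left one_right in \<open>auto simp: group_algebra_simps(1,3)\<close>)
  qed (auto simp: group_algebra_simps(2,5) fun_eq_iff sum.distrib[symmetric]
        distrib_right distrib_left intro!: sum.cong)
qed

section \<open>Polynomials in one and two variables over the group algebra\<close>

definition sym_algebra :: "nat \<Rightarrow> ((nat \<Rightarrow> nat) \<Rightarrow> rat) ring" where
  "sym_algebra n = group_algebra (sym_group n)"

abbreviation uni_poly_ring where
  "uni_poly_ring n \<equiv> UP (sym_algebra n)"

abbreviation biv_poly_ring where
  "biv_poly_ring n \<equiv> UP (uni_poly_ring n)"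

text \<open>The inner variable of \<open>biv_poly_ring n\<close> is called \<open>x\<close>, the outer one \<open>y\<close>.\<close>

definition biv_const :: "nat \<Rightarrow> ((nat \<Rightarrow> nat) \<Rightarrow> rat) \<Rightarrow> nat \<Rightarrow> nat \<Rightarrow> (nat \<Rightarrow> nat) \<Rightarrow> rat" where
  "biv_const n a = up_ring.monom (biv_poly_ring n) (up_ring.monom (uni_poly_ring n) a 0) 0"

definition var_x :: "nat \<Rightarrow> nat \<Rightarrow> nat \<Rightarrow> (nat \<Rightarrow> nat) \<Rightarrow> rat" where
  "var_x n = up_ring.monom (biv_poly_ring n)
               (up_ring.monom (uni_poly_ring n) \<one>\<^bsub>sym_algebra n\<^esub> 1) 0"

definition var_y :: "nat \<Rightarrow> nat \<Rightarrow> nat \<Rightarrow> (nat \<Rightarrow> nat) \<Rightarrow> rat" where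
  "var_y n = up_ring.monom (biv_poly_ring n) \<one>\<^bsub>uni_poly_ring n\<^esub> 1"

definition subst_biv ::
  "nat \<Rightarrow> (nat \<Rightarrow> (nat \<Rightarrow> nat) \<Rightarrow> rat) \<Rightarrow> (nat \<Rightarrow> nat \<Rightarrow> (nat \<Rightarrow> nat) \<Rightarrow> rat) \<Rightarrow>
    nat \<Rightarrow> nat \<Rightarrow> (nat \<Rightarrow> nat) \<Rightarrow> rat" where
  "subst_biv n p t = eval (sym_algebra n) (biv_poly_ring n) (biv_const n) t p"

section \<open>Descents and the polynomials phi and psi\<close>

definition des :: "nat \<Rightarrow> (nat \<Rightarrow> nat) \<Rightarrow> nat" where
  "des n \<pi> = card {i \<in> {1..n-1}. \<pi> i > \<pi> (i + 1)}"

definition cdes :: "nat \<Rightarrow> (nat \<Rightarrow> nat) \<Rightarrow> nat" where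
  "cdes n \<pi> = card {i \<in> {1..n}. \<pi> i > \<pi> (if i = n then 1 else i + 1)}"

text \<open>\<open>poly_times_perm c \<pi>\<close> is the product of the scalar polynomial \<open>c\<close> and the permutation \<open>\<pi>\<close>.\<close>

definition poly_times_perm :: "rat poly \<Rightarrow> (nat \<Rightarrow> nat) \<Rightarrow> nat \<Rightarrow> (nat \<Rightarrow> nat) \<Rightarrow> rat" where
  "poly_times_perm c \<pi> = (\<lambda>k \<tau>. if \<tau> = \<pi> then poly.coeff c k else 0)"

text \<open>In the following, \<open>[:a, 1:]\<close> is the polynomial \<open>x + a\<close>.\<close>

definition binom_poly :: "rat poly \<Rightarrow> nat \<Rightarrow> rat poly" where
  "binom_poly p m = smult (1 / fact m) (\<Prod>i<m. p - of_nat i)"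

definition phi_coeff :: "nat \<Rightarrow> (nat \<Rightarrow> nat) \<Rightarrow> rat poly" where
  "phi_coeff n \<pi> = binom_poly [:of_nat n - 1 - of_nat (des n \<pi>), 1:] n"

definition psi_coeff :: "nat \<Rightarrow> (nat \<Rightarrow> nat) \<Rightarrow> rat poly" where
  "psi_coeff n \<pi> =
     [:0, 1 / of_nat n:] * binom_poly [:of_nat n - 1 - of_nat (cdes n \<pi>), 1:] (n - 1)"

definition phi :: "nat \<Rightarrow> nat \<Rightarrow> (nat \<Rightarrow> nat) \<Rightarrow> rat" where
  "phi n = (\<Oplus>\<^bsub>uni_poly_ring n\<^esub>\<pi>\<in>{\<pi>. \<pi> permutes {1..n}}. poly_times_perm (phi_coeff n \<pi>) \<pi>)"

definition psi :: "nat \<Rightarrow> nat \<Rightarrow> (nat \<Rightarrow> nat) \<Rightarrow> rat" where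
  "psi n = (\<Oplus>\<^bsub>uni_poly_ring n\<^esub>\<pi>\<in>{\<pi>. \<pi> permutes {1..n}}. poly_times_perm (psi_coeff n \<pi>) \<pi>)"

section \<open>Basic facts\<close>

lemma poly_binom_poly: "poly (binom_poly p m) z = poly p z gchoose m"
  by (simp add: binom_poly_def poly_prod gbinomial_prod_rev atLeast0LessThan)

lemma ring_sym_algebra: "ring (sym_algebra n)"
  unfolding sym_algebra_def
  by (rule group.ring_group_algebra[OF sym_group_is_group])
    (simp add: sym_group_def finite_permutations)

lemma ring_uni_poly_ring: "ring (uni_poly_ring n)"
  by (intro UP_ring.UP_ring UP_ring.intro ring_sym_algebra)

lemma ring_biv_poly_ring: "ring (biv_poly_ring n)"
  by (intro UP_ring.UP_ring UP_ring.intro ring_uni_poly_ring)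

lemma poly_times_perm_closed:
  assumes "\<pi> permutes {1..n}"
  shows "poly_times_perm c \<pi> \<in> carrier (uni_poly_ring n)"
proof -
  have "bound \<zero>\<^bsub>sym_algebra n\<^esub> (Polynomial.degree c) (poly_times_perm c \<pi>)"
    by (auto simp: poly_times_perm_def sym_algebra_def group_algebra_simps fun_eq_iff coeff_eq_0)
  then show ?thesis
    using assms
    by (auto simp: UP_def up_def poly_times_perm_def sym_algebra_def group_algebra_simps
        sym_group_carrier)
qed

lemma uni_poly_ring_add:
  assumes "p \<in> carrier (uni_poly_ring n)" "q \<in> carrier (uni_poly_ring n)"
  shows "p \<oplus>\<^bsub>uni_poly_ring n\<^esub> q = (\<lambda>k \<tau>. p k \<tau> + q k \<tau>)"
  using assms by (simp add: UP_def sym_algebra_def group_algebra_simps)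

lemma finsum_poly_times_perm:
  assumes "finite S" "S \<subseteq> {\<pi>. \<pi> permutes {1..n}}"
  shows "(\<Oplus>\<^bsub>uni_poly_ring n\<^esub>\<pi>\<in>S. poly_times_perm (c \<pi>) \<pi>) =
    (\<lambda>k \<tau>. if \<tau> \<in> S then poly.coeff (c \<tau>) k else 0)"
  using assms
proof (induction S rule: finite_induct)
  case empty
  interpret U: ring "uni_poly_ring n" by (rule ring_uni_poly_ring)
  show ?case by (simp only: U.finsum_empty) (simp add: UP_def sym_algebra_def group_algebra_simps)
next
  case (insert \<pi> S)
  interpret U: ring "uni_poly_ring n" by (rule ring_uni_poly_ring)
  let ?s = "\<Oplus>\<^bsub>uni_poly_ring n\<^esub>\<pi>\<in>S. poly_times_perm (c \<pi>) \<pi>"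
  have cl: "(\<lambda>\<pi>. poly_times_perm (c \<pi>) \<pi>) \<in> S \<rightarrow> carrier (uni_poly_ring n)"
    "poly_times_perm (c \<pi>) \<pi> \<in> carrier (uni_poly_ring n)"
    using insert.prems by (auto intro!: poly_times_perm_closed)
  have s: "?s \<in> carrier (uni_poly_ring n)" by (rule U.finsum_closed[OF cl(1)])
  have "(\<Oplus>\<^bsub>uni_poly_ring n\<^esub>\<pi>\<in>insert \<pi> S. poly_times_perm (c \<pi>) \<pi>) =
      poly_times_perm (c \<pi>) \<pi> \<oplus>\<^bsub>uni_poly_ring n\<^esub> ?s"
    using U.finsum_insert[OF insert.hyps cl(1)] cl(2) by blast
  also have "\<dots> = (\<lambda>k \<tau>. poly_times_perm (c \<pi>) \<pi> k \<tau> + ?s k \<tau>)"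
    by (rule uni_poly_ring_add[OF cl(2) s])
  also have "?s = (\<lambda>k \<tau>. if \<tau> \<in> S then poly.coeff (c \<tau>) k else 0)"
    using insert.IH insert.prems by simp
  finally show ?case
    using insert.hyps by (auto simp: poly_times_perm_def intro!: ext)
qed

lemma phi_apply:
  "phi n k \<tau> = (if \<tau> permutes {1..n} then poly.coeff (phi_coeff n \<tau>) k else 0)"
  unfolding phi_def by (subst finsum_poly_times_perm) (auto simp: finite_permutations)

lemma psi_apply:
  "psi n k \<tau> = (if \<tau> permutes {1..n} then poly.coeff (psi_coeff n \<tau>) k else 0)"
  unfolding psi_def by (subst finsum_poly_times_perm) (auto simp: finite_permutations)

lemma phi_closed: "phi n \<in> carrier (uni_poly_ring n)"
  and psi_closed: "psi n \<in> carrier (uni_poly_ring n)"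
proof -
  interpret U: ring "uni_poly_ring n" by (rule ring_uni_poly_ring)
  show "phi n \<in> carrier (uni_poly_ring n)" "psi n \<in> carrier (uni_poly_ring n)"
    unfolding phi_def psi_def by (auto intro!: U.finsum_closed poly_times_perm_closed)
qed

end

theory Submission
  imports Defs "HOL-Number_Theory.Cong"
begin

text \<open>
  For a natural number \<open>a\<close>, the coefficient of \<open>\<sigma>\<close> in \<open>\<phi>(a)\<close> counts the words \<open>f\<close> of length \<open>n\<close>
  over \<open>a\<close> letters whose positions are stably sorted by \<open>\<sigma>\<close>. If \<open>\<sigma>\<close> sorts \<open>f\<close> and \<open>\<tau>\<close> sorts
  \<open>g\<close>, then \<open>\<sigma>\<tau>\<close> sorts the word of pairs \<open>(g(\<sigma>\<^sup>-\<^sup>1 p), f(p))\<close> in the lexicographic order, and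
  every word of pairs arises exactly once; hence \<open>\<phi>(a)\<phi>(b) = \<phi>(ab)\<close>. Comparing the descents of
  the \<open>n\<close> rotations of \<open>\<pi>\<close> with its cyclic descents gives \<open>n\<psi>(x) = \<phi>(x)C\<close>, where \<open>C\<close> is the sum
  of the rotations. So \<open>n\<phi>(a)\<psi>(b) = \<phi>(a)\<phi>(b)C = \<phi>(ab)C = n\<psi>(ab)\<close>, and agreement at all natural
  numbers determines the coefficients of the polynomials.
\<close>

section \<open>Sorting permutations of words\<close>

text \<open>Here \<open>\<sigma>\<close> sends ranks to positions: \<open>\<sigma> i\<close> is the
  place of the \<open>i\<close>-th letter in sorted order. Breaking ties by position makes the order
  strict, so that only one permutation sorts a given word.\<close>

definition sorts :: "nat \<Rightarrow> (nat \<Rightarrow> nat) \<Rightarrow> (nat \<Rightarrow> nat) \<Rightarrow> bool" where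
  "sorts n f \<sigma> \<longleftrightarrow> (\<forall>i\<in>{1..n}. \<forall>j\<in>{1..n}. i < j \<longrightarrow>
     f (\<sigma> i) < f (\<sigma> j) \<or> f (\<sigma> i) = f (\<sigma> j) \<and> \<sigma> i < \<sigma> j)"

lemma sorts_less_iff:
  assumes "sorts n f \<sigma>" "i \<in> {1..n}" "j \<in> {1..n}"
  shows "f (\<sigma> i) < f (\<sigma> j) \<or> f (\<sigma> i) = f (\<sigma> j) \<and> \<sigma> i < \<sigma> j \<longleftrightarrow> i < j"
  using assms unfolding sorts_def by (metis less_asym' less_irrefl linorder_neqE_nat)

text \<open>The candidate inverse of the sorting permutation. The position \<open>p\<close> counts
  itself, so ranks start at 1.\<close>

definition stable_rank :: "nat \<Rightarrow> (nat \<Rightarrow> nat) \<Rightarrow> nat \<Rightarrow> nat" where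
  "stable_rank n f p = card {q \<in> {1..n}. f q < f p \<or> f q = f p \<and> q \<le> p}"

text \<open>A sorting \<open>\<sigma>\<close> is an order isomorphism from ranks to positions, so
  the positions not after \<open>\<sigma> i\<close> are the images of \<open>{1..i}\<close>.\<close>

lemma stable_rank_sorts:
  assumes "\<sigma> permutes {1..n}" "sorts n f \<sigma>" "i \<in> {1..n}"
  shows "stable_rank n f (\<sigma> i) = i"
proof -
  have inj: "inj \<sigma>" using assms(1) by (rule permutes_inj)
  have "{q \<in> {1..n}. f q < f (\<sigma> i) \<or> f q = f (\<sigma> i) \<and> q \<le> \<sigma> i} = \<sigma> ` {1..i}" (is "?L = ?R")
  proof
    show "?L \<subseteq> ?R"
    proof
      fix q assume q: "q \<in> ?L"
      then have "q \<in> \<sigma> ` {1..n}" using permutes_image[OF assms(1)] by auto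
      then obtain j where j: "j \<in> {1..n}" "q = \<sigma> j" by blast
      have "\<not> i < j" using q j(2) sorts_less_iff[OF assms(2,3) j(1)] by auto
      then show "q \<in> ?R" using j by auto
    qed
  next
    show "?R \<subseteq> ?L"
    proof
      fix q assume "q \<in> ?R"
      then obtain j where j: "j \<in> {1..i}" "q = \<sigma> j" by blast
      then have jn: "j \<in> {1..n}" using assms(3) by auto
      then have "q \<in> {1..n}" using j permutes_in_image[OF assms(1)] by simp
      moreover have "f q < f (\<sigma> i) \<or> f q = f (\<sigma> i) \<and> q \<le> \<sigma> i"
        using sorts_less_iff[OF assms(2) jn assms(3)] j by (cases "j = i") auto
      ultimately show "q \<in> ?L" by simp
    qed
  qed
  then show ?thesis
    unfolding stable_rank_def using card_image[OF inj_on_subset[OF inj]] by simp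
qed

text \<open>The rank function is a left inverse of both permutations on \<open>{1..n}\<close>, and
  it depends on \<open>f\<close> alone.\<close>

lemma sorts_unique:
  assumes "\<sigma> permutes {1..n}" "sorts n f \<sigma>" "\<tau> permutes {1..n}" "sorts n f \<tau>"
  shows "\<sigma> = \<tau>"
proof
  fix i
  show "\<sigma> i = \<tau> i"
  proof (cases "i \<in> {1..n}")
    case True
    then have "\<sigma> i \<in> \<tau> ` {1..n}"
      using permutes_in_image[OF assms(1)] permutes_image[OF assms(3)] by simp
    then obtain j where j: "j \<in> {1..n}" "\<sigma> i = \<tau> j" by blast
    then have "i = j"
      using stable_rank_sorts[OF assms(1,2) True] stable_rank_sorts[OF assms(3,4) j(1)] by simp
    then show ?thesis using j by simp
  next
    case False
    then show ?thesis using assms(1,3) by (simp add: permutes_not_in)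
  qed
qed

text \<open>The rank is strictly monotone in the total order on pairs (letter, position), hence a
  bijection of \<open>{1..n}\<close>; its inverse sorts \<open>f\<close>.\<close>

lemma sorts_exists: "\<exists>\<sigma>. \<sigma> permutes {1..n} \<and> sorts n f \<sigma>"
proof -
  define less where "less p q \<longleftrightarrow> f p < f q \<or> f p = f q \<and> p < q" for p q
  have mono: "stable_rank n f p < stable_rank n f q" if "p \<in> {1..n}" "q \<in> {1..n}" "less p q" for p q
  proof -
    have "q \<notin> {r \<in> {1..n}. f r < f p \<or> f r = f p \<and> r \<le> p}"
      using that(3) by (auto simp: less_def)
    moreover have "q \<in> {r \<in> {1..n}. f r < f q \<or> f r = f q \<and> r \<le> q}"
      using that(2) by simp
    moreover have "{r \<in> {1..n}. f r < f p \<or> f r = f p \<and> r \<le> p}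
        \<subseteq> {r \<in> {1..n}. f r < f q \<or> f r = f q \<and> r \<le> q}"
      using that(3) by (auto simp: less_def)
    ultimately show ?thesis
      unfolding stable_rank_def by (intro psubset_card_mono) auto
  qed
  have total: "less p q \<or> p = q \<or> less q p" for p q by (auto simp: less_def)
  have inj: "inj_on (stable_rank n f) {1..n}"
    by (rule inj_onI) (metis mono total less_irrefl)
  have "stable_rank n f ` {1..n} \<subseteq> {1..n}"
  proof
    fix r assume "r \<in> stable_rank n f ` {1..n}"
    then obtain p where p: "p \<in> {1..n}" "r = stable_rank n f p" by blast
    have "r \<le> card {1..n}" unfolding p(2) stable_rank_def by (rule card_mono) auto
    moreover have "card {p} \<le> r" unfolding p(2) stable_rank_def by (rule card_mono) (use p in auto)
    ultimately show "r \<in> {1..n}" by simp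
  qed
  then have bij: "bij_betw (stable_rank n f) {1..n} {1..n}"
    using inj by (simp add: bij_betw_def endo_inj_surj)
  \<comment> \<open>The rank is replaced by the identity outside \<open>{1..n}\<close>, as
    \<open>permutes\<close> demands.\<close>
  define \<rho> where "\<rho> p = (if p \<in> {1..n} then stable_rank n f p else p)" for p
  have \<rho>: "\<rho> permutes {1..n}"
  proof (rule bij_imp_permutes)
    show "bij_betw \<rho> {1..n} {1..n}"
      using bij by (rule bij_betw_cong[THEN iffD1, rotated]) (simp add: \<rho>_def)
  qed (auto simp: \<rho>_def)
  have inv\<rho>: "inv' \<rho> permutes {1..n}" by (rule permutes_inv[OF \<rho>])
  have "sorts n f (inv' \<rho>)"
    unfolding sorts_def less_def[symmetric]
  proof (intro ballI impI)
    fix i j assume ij: "i \<in> {1..n}" "j \<in> {1..n}" "i < j"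
    have in': "inv' \<rho> i \<in> {1..n}" "inv' \<rho> j \<in> {1..n}"
      using ij permutes_in_image[OF inv\<rho>] by auto
    have "\<rho> (inv' \<rho> i) = i" "\<rho> (inv' \<rho> j) = j" by (simp_all add: permutes_inverses[OF \<rho>])
    then have "stable_rank n f (inv' \<rho> i) = i" "stable_rank n f (inv' \<rho> j) = j"
      using in' by (simp_all add: \<rho>_def)
    then show "less (inv' \<rho> i) (inv' \<rho> j)"
      using mono[OF in'(2,1)] total[of "inv' \<rho> i" "inv' \<rho> j"] ij(3) by fastforce
  qed
  then show ?thesis using inv\<rho> by blast
qed

section \<open>Pairs of words coded as words over a product alphabet\<close>

definition sorted_words :: "nat \<Rightarrow> nat \<Rightarrow> (nat \<Rightarrow> nat) \<Rightarrow> (nat \<Rightarrow> nat) set" where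
  "sorted_words n m \<sigma> = {f \<in> {1..n} \<rightarrow>\<^sub>E {..<m}. sorts n f \<sigma>}"

lemma finite_sorted_words: "finite (sorted_words n m \<sigma>)"
  unfolding sorted_words_def by (simp add: finite_PiE)

lemma lex_code_less_iff:
  fixes a u v x y :: nat
  assumes "x < a" "y < a"
  shows "u * a + x < v * a + y \<longleftrightarrow> u < v \<or> u = v \<and> x < y"
proof -
  have "u * a + x < v * a + y" if "u < v" "x < a" for u v x y
  proof -
    have "u * a + a \<le> v * a" using that(1) mult_le_mono1[of "Suc u" v a] by simp
    then show ?thesis using that(2) by simp
  qed
  from this[of u v x y] this[of v u y x] show ?thesis using assms by (cases u v rule: linorder_cases) auto
qed

lemma lex_code_eq_iff:
  fixes a u v x y :: nat
  assumes "x < a" "y < a"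
  shows "u * a + x = v * a + y \<longleftrightarrow> u = v \<and> x = y"
  using lex_code_less_iff[OF assms, of u v] lex_code_less_iff[OF assms(2,1), of v u]
  by (metis less_irrefl linorder_neqE_nat)

text \<open>The word \<open>h\<close> is compared first by \<open>g\<close>, then by
  \<open>f\<close>, then by position. Since \<open>\<sigma>\<close> sorts \<open>f\<close>, the last
  two comparisons at \<open>\<sigma> (\<tau> i)\<close> and \<open>\<sigma> (\<tau> j)\<close>
  together mean \<open>\<tau> i < \<tau> j\<close>, which is the tie-break for
  \<open>g\<close>.\<close>

lemma sorts_lex_code_iff:
  assumes "\<sigma> permutes {1..n}" "\<tau> permutes {1..n}" "sorts n f \<sigma>"
    and "\<And>p. p \<in> {1..n} \<Longrightarrow> f p < a"
    and "\<And>p. p \<in> {1..n} \<Longrightarrow> h (\<sigma> p) = g p * a + f (\<sigma> p)"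
  shows "sorts n h (\<sigma> \<circ> \<tau>) \<longleftrightarrow> sorts n g \<tau>"
proof -
  have "h (\<sigma> (\<tau> i)) < h (\<sigma> (\<tau> j)) \<or> h (\<sigma> (\<tau> i)) = h (\<sigma> (\<tau> j)) \<and> \<sigma> (\<tau> i) < \<sigma> (\<tau> j) \<longleftrightarrow>
        g (\<tau> i) < g (\<tau> j) \<or> g (\<tau> i) = g (\<tau> j) \<and> \<tau> i < \<tau> j"
    if "i \<in> {1..n}" "j \<in> {1..n}" for i j
  proof -
    have \<tau>: "\<tau> i \<in> {1..n}" "\<tau> j \<in> {1..n}" using that permutes_in_image[OF assms(2)] by auto
    then have "\<sigma> (\<tau> i) \<in> {1..n}" "\<sigma> (\<tau> j) \<in> {1..n}" using permutes_in_image[OF assms(1)] by auto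
    then have "f (\<sigma> (\<tau> i)) < a" "f (\<sigma> (\<tau> j)) < a" using assms(4) by blast+
    then show ?thesis
      using sorts_less_iff[OF assms(3) \<tau>] assms(5)[OF \<tau>(1)] assms(5)[OF \<tau>(2)]
        lex_code_less_iff lex_code_eq_iff by auto
  qed
  then show ?thesis by (simp add: sorts_def)
qed

text \<open>Each summand counts pairs of words sorted by the two factors of \<open>\<pi>\<close>.
  The triples \<open>(\<sigma>, f, g)\<close> correspond to words over \<open>a * b\<close> letters,
  with \<open>f\<close> as low digit and \<open>g\<close>, transported by \<open>\<sigma>\<close>,
  as high digit.\<close>

lemma sum_card_sorted_words:
  assumes \<pi>: "\<pi> permutes {1..n}"
  shows "(\<Sum>\<sigma> | \<sigma> permutes {1..n}.
            card (sorted_words n a \<sigma>) * card (sorted_words n b (inv' \<sigma> \<circ> \<pi>))) =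
         card (sorted_words n (a * b) \<pi>)"
proof -
  let ?P = "{\<sigma>. \<sigma> permutes {1..n}}"
  let ?S = "SIGMA \<sigma>:?P. sorted_words n a \<sigma> \<times> sorted_words n b (inv' \<sigma> \<circ> \<pi>)"
  define code :: "(nat \<Rightarrow> nat) \<times> (nat \<Rightarrow> nat) \<times> (nat \<Rightarrow> nat) \<Rightarrow> nat \<Rightarrow> nat" where
    "code = (\<lambda>(\<sigma>, f, g). \<lambda>p\<in>{1..n}. g (inv' \<sigma> p) * a + f p)"
  have "bij_betw code ?S (sorted_words n (a * b) \<pi>)"
  proof (rule bij_betw_imageI[OF inj_onI equalityI[OF subsetI subsetI]])
    fix s t assume s: "s \<in> ?S" and t: "t \<in> ?S" and eq: "code s = code t"
    obtain \<sigma> f g where s': "s = (\<sigma>, f, g)" by (cases s)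
    obtain \<sigma>' f' g' where t': "t = (\<sigma>', f', g')" by (cases t)
    have \<sigma>: "\<sigma> permutes {1..n}" "\<sigma>' permutes {1..n}"
      and f: "f \<in> {1..n} \<rightarrow>\<^sub>E {..<a}" "f' \<in> {1..n} \<rightarrow>\<^sub>E {..<a}" "sorts n f \<sigma>" "sorts n f' \<sigma>'"
      and g: "g \<in> {1..n} \<rightarrow>\<^sub>E {..<b}" "g' \<in> {1..n} \<rightarrow>\<^sub>E {..<b}"
      using s t by (auto simp: s' t' sorted_words_def)
    have pt: "g (inv' \<sigma> p) = g' (inv' \<sigma>' p)" "f p = f' p" if "p \<in> {1..n}" for p
      using fun_cong[OF eq, of p] that f(1,2)
        lex_code_eq_iff[of "f p" a "f' p" "g (inv' \<sigma> p)" "g' (inv' \<sigma>' p)"]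
      by (auto simp: s' t' code_def PiE_iff)
    \<comment> \<open>The low digits give \<open>f\<close>, the word \<open>f\<close> forces
      \<open>\<sigma>\<close>, and only then can \<open>g\<close> be read off from the high
      digits.\<close>
    have ff: "f = f'" by (rule PiE_ext[OF f(1,2)]) (rule pt)
    then have \<sigma>\<sigma>: "\<sigma> = \<sigma>'" using sorts_unique \<sigma> f(3,4) by blast
    have "g = g'"
    proof (rule PiE_ext[OF g])
      fix q assume "q \<in> {1..n}"
      then have "\<sigma> q \<in> {1..n}" using permutes_in_image[OF \<sigma>(1)] by simp
      from pt(1)[OF this] show "g q = g' q"
        by (simp add: \<sigma>\<sigma>[symmetric] permutes_inverses[OF \<sigma>(1)])
    qed
    then show "s = t" using s' t' ff \<sigma>\<sigma> by simp
  next
    fix h assume "h \<in> code ` ?S"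
    then obtain \<sigma> f g where \<sigma>: "\<sigma> permutes {1..n}" and f: "f \<in> {1..n} \<rightarrow>\<^sub>E {..<a}" "sorts n f \<sigma>"
      and g: "g \<in> {1..n} \<rightarrow>\<^sub>E {..<b}" "sorts n g (inv' \<sigma> \<circ> \<pi>)" and h: "h = code (\<sigma>, f, g)"
      by (auto simp: sorted_words_def)
    have \<tau>: "inv' \<sigma> \<circ> \<pi> permutes {1..n}"
      by (rule permutes_compose[OF \<pi> permutes_inv[OF \<sigma>]])
    have h\<sigma>: "h (\<sigma> p) = g p * a + f (\<sigma> p)" if "p \<in> {1..n}" for p
      using that permutes_in_image[OF \<sigma>, of p] by (simp add: h code_def permutes_inverses[OF \<sigma>])
    have fa: "f p < a" if "p \<in> {1..n}" for p using f(1) that by auto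
    have "sorts n h (\<sigma> \<circ> (inv' \<sigma> \<circ> \<pi>))"
      using sorts_lex_code_iff[OF \<sigma> \<tau> f(2) fa h\<sigma>] g(2) by simp
    moreover have "\<sigma> \<circ> (inv' \<sigma> \<circ> \<pi>) = \<pi>" by (simp add: fun_eq_iff permutes_inverses[OF \<sigma>])
    moreover have "h \<in> {1..n} \<rightarrow>\<^sub>E {..<a * b}"
    proof (rule PiE_I)
      fix p assume p: "p \<in> {1..n}"
      then have "inv' \<sigma> p \<in> {1..n}" using permutes_in_image[OF permutes_inv[OF \<sigma>]] by simp
      then have "g (inv' \<sigma> p) < b" "f p < a" using f(1) g(1) p by (auto simp: PiE_iff)
      \<comment> \<open>The pair of digits precedes \<open>(b, 0)\<close> lexicographically, which
        bounds its code by \<open>b * a\<close>.\<close>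
      then have "g (inv' \<sigma> p) * a + f p < b * a + 0"
        using lex_code_less_iff[of "f p" a 0] by simp
      then show "h p \<in> {..<a * b}" using p by (simp add: h code_def mult.commute)
    qed (auto simp: h code_def)
    ultimately show "h \<in> sorted_words n (a * b) \<pi>" by (simp add: sorted_words_def)
  next
    fix h assume "h \<in> sorted_words n (a * b) \<pi>"
    then have h: "h \<in> {1..n} \<rightarrow>\<^sub>E {..<a * b}" "sorts n h \<pi>" by (auto simp: sorted_words_def)
    \<comment> \<open>Decoding: \<open>f\<close> is the low digit, \<open>\<sigma>\<close> the
      permutation that sorts it, and \<open>g\<close> the high digit read in the order given by
      \<open>\<sigma>\<close>.\<close>
    define f where "f = (\<lambda>p\<in>{1..n}. h p mod a)"
    obtain \<sigma> where \<sigma>: "\<sigma> permutes {1..n}" "sorts n f \<sigma>" using sorts_exists by blast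
    define g where "g = (\<lambda>p\<in>{1..n}. h (\<sigma> p) div a)"
    have hp: "h p < a * b" if "p \<in> {1..n}" for p using h(1) that by auto
    have fa: "f p < a" if "p \<in> {1..n}" for p
      using hp[OF that] that by (cases "a = 0") (auto simp: f_def)
    have "g p < b" if "p \<in> {1..n}" for p
      using hp[of "\<sigma> p"] that permutes_in_image[OF \<sigma>(1), of p]
      by (auto simp: g_def less_mult_imp_div_less mult.commute)
    then have g: "g \<in> {1..n} \<rightarrow>\<^sub>E {..<b}" by (auto simp: g_def)
    have \<tau>: "inv' \<sigma> \<circ> \<pi> permutes {1..n}"
      by (rule permutes_compose[OF \<pi> permutes_inv[OF \<sigma>(1)]])
    have h\<sigma>: "h (\<sigma> p) = g p * a + f (\<sigma> p)" if "p \<in> {1..n}" for p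
      using that permutes_in_image[OF \<sigma>(1), of p] by (simp add: g_def f_def)
    have "\<sigma> \<circ> (inv' \<sigma> \<circ> \<pi>) = \<pi>" by (simp add: fun_eq_iff permutes_inverses[OF \<sigma>(1)])
    then have "sorts n g (inv' \<sigma> \<circ> \<pi>)"
      using sorts_lex_code_iff[OF \<sigma>(1) \<tau> \<sigma>(2) fa h\<sigma>] h(2) by simp
    moreover have "f \<in> {1..n} \<rightarrow>\<^sub>E {..<a}" using fa by (auto simp: f_def)
    moreover have "h = code (\<sigma>, f, g)"
    proof
      fix p
      show "h p = code (\<sigma>, f, g) p"
      proof (cases "p \<in> {1..n}")
        case True
        then have "inv' \<sigma> p \<in> {1..n}" using permutes_in_image[OF permutes_inv[OF \<sigma>(1)]] by simp
        from h\<sigma>[OF this] show ?thesis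
          using True by (simp add: code_def permutes_inverses[OF \<sigma>(1)])
      next
        case False
        then show ?thesis using PiE_arb[OF h(1)] by (auto simp: code_def)
      qed
    qed
    ultimately show "h \<in> code ` ?S" using \<sigma> g by (auto simp: sorted_words_def)
  qed
  then have "card ?S = card (sorted_words n (a * b) \<pi>)" by (rule bij_betw_same_card)
  moreover have "card ?S = (\<Sum>\<sigma>\<in>?P. card (sorted_words n a \<sigma>) * card (sorted_words n b (inv' \<sigma> \<circ> \<pi>)))"
    by (simp add: card_SigmaI finite_permutations finite_sorted_words card_cartesian_product)
  ultimately show ?thesis by simp
qed

section \<open>Counting the words sorted by a permutation\<close>

text \<open>For \<open>s\<close> with values 0 and 1 these are the weakly increasing words that must
  rise strictly where \<open>s\<close> is 1.\<close>

definition spaced_words :: "(nat \<Rightarrow> nat) \<Rightarrow> nat \<Rightarrow> nat \<Rightarrow> (nat \<Rightarrow> nat) set" where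
  "spaced_words s n m = {c \<in> {1..n} \<rightarrow>\<^sub>E {..<m}. \<forall>i\<in>{1..<n}. c i + s i \<le> c (Suc i)}"

lemma finite_spaced_words: "finite (spaced_words s n m)"
  unfolding spaced_words_def by (simp add: finite_PiE)

text \<open>Induction on the length, and inside it on the alphabet, yields Pascal's recursion. Only
  \<open>s 1\<close> to \<open>s (n - 1)\<close> constrain the word; \<open>s 0 = 0\<close> lets the
  sum run over all \<open>i < n\<close>.\<close>

lemma card_spaced_words:
  assumes "s 0 = 0" "\<And>i. s i \<le> 1"
  shows "card (spaced_words s n m) = (m + n - 1 - (\<Sum>i<n. s i)) choose n"
proof (induction n arbitrary: m)
  case 0
  show ?case by (simp add: spaced_words_def)
next
  case (Suc n)
  note IH = Suc.IH
  \<comment> \<open>This bound keeps the natural subtractions below from truncating.\<close>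
  have d: "(\<Sum>i<Suc n. s i) \<le> n"
  proof -
    have "(\<Sum>i<Suc n. s i) = (\<Sum>i<n. s (Suc i))" using assms(1) by (simp add: sum.lessThan_Suc_shift del: sum.lessThan_Suc)
    also have "\<dots> \<le> (\<Sum>i<n. 1)" by (rule sum_mono) (rule assms(2))
    finally show ?thesis by simp
  qed
  show ?case
  proof (induction m)
    case 0
    have "spaced_words s (Suc n) 0 = {}" by (auto simp: spaced_words_def PiE_iff)
    then show ?case by simp
  next
    case (Suc m)
    \<comment> \<open>Pascal's rule, by whether the last letter is the greatest one\<close>
    let ?T = "{c \<in> spaced_words s (Suc n) (Suc m). c (Suc n) = m}"
    have split: "spaced_words s (Suc n) (Suc m) = spaced_words s (Suc n) m \<union> ?T"
    proof
      show "spaced_words s (Suc n) (Suc m) \<subseteq> spaced_words s (Suc n) m \<union> ?T"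
      proof
        fix c assume c: "c \<in> spaced_words s (Suc n) (Suc m)"
        \<comment> \<open>The word increases weakly, so a last letter other than \<open>m\<close>
          keeps all letters below \<open>m\<close>.\<close>
        have "c i \<le> c (Suc n)" if "i \<in> {1..Suc n}" for i
        proof -
          have "i \<le> Suc n" using that by simp
          then show ?thesis
          proof (induction rule: inc_induct)
            case (step k)
            have "c k + s k \<le> c (Suc k)" using c step.hyps that by (auto simp: spaced_words_def)
            then show ?case using step.IH by simp
          qed simp
        qed
        moreover have "c (Suc n) < Suc m" using c by (auto simp: spaced_words_def)
        ultimately have "c i < m" if "c (Suc n) \<noteq> m" "i \<in> {1..Suc n}" for i
          using that by (metis le_neq_implies_less less_Suc_eq_le order_le_less_trans)
        then show "c \<in> spaced_words s (Suc n) m \<union> ?T"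
          using c by (cases "c (Suc n) = m") (simp_all add: spaced_words_def PiE_iff)
      qed
    qed (auto simp: spaced_words_def PiE_iff less_Suc_eq)
    \<comment> \<open>Deleting the final letter \<open>m\<close> leaves a word of length
      \<open>n\<close>; the last gap condition \<open>c n + s n \<le> m\<close> becomes the smaller
      alphabet \<open>Suc m - s n\<close>.\<close>
    have bij: "bij_betw (\<lambda>c. c(Suc n := m)) (spaced_words s n (Suc m - s n)) ?T"
    proof (rule bij_betw_byWitness[where f' = "\<lambda>c. c(Suc n := undefined)"])
      show "\<forall>c\<in>spaced_words s n (Suc m - s n). (c(Suc n := m))(Suc n := undefined) = c"
        by (auto simp: spaced_words_def fun_eq_iff PiE_iff extensional_def)
      show "\<forall>c\<in>?T. (c(Suc n := undefined))(Suc n := m) = c"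
        by auto
      show "(\<lambda>c. c(Suc n := m)) ` spaced_words s n (Suc m - s n) \<subseteq> ?T"
      proof (intro image_subsetI)
        fix c assume c: "c \<in> spaced_words s n (Suc m - s n)"
        then have c1: "c i < Suc m - s n" if "i \<in> {1..n}" for i
          using that by (auto simp: spaced_words_def)
        have c2: "c i + s i \<le> c (Suc i)" if "i \<in> {1..<n}" for i
          using c that by (auto simp: spaced_words_def)
        have "(c(Suc n := m)) \<in> {1..Suc n} \<rightarrow>\<^sub>E {..<Suc m}"
          using c c1 by (fastforce simp: spaced_words_def PiE_iff extensional_def)
        moreover have "(c(Suc n := m)) i + s i \<le> (c(Suc n := m)) (Suc i)" if "i \<in> {1..<Suc n}" for i
          using that c1[of i] c2[of i] by (cases "i = n") auto
        ultimately show "c(Suc n := m) \<in> ?T" by (simp add: spaced_words_def)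
      qed
      show "(\<lambda>c. c(Suc n := undefined)) ` ?T \<subseteq> spaced_words s n (Suc m - s n)"
      proof (intro image_subsetI)
        fix c assume c: "c \<in> ?T"
        have c2: "c i + s i \<le> c (Suc i)" if "i \<in> {1..n}" for i
          using c that by (auto simp: spaced_words_def)
        have top: "c i \<le> c n" if "i \<in> {1..n}" for i
        proof -
          have "i \<le> n" using that by simp
          then show ?thesis
          proof (induction rule: inc_induct)
            case (step k)
            have "c k + s k \<le> c (Suc k)" using c2[of k] step.hyps that by auto
            then show ?case using step.IH by simp
          qed simp
        qed
        have "c i < Suc m - s n" if "i \<in> {1..n}" for i
          using top[OF that] c2[of n] c that by auto
        then show "c(Suc n := undefined) \<in> spaced_words s n (Suc m - s n)"
          using c c2 by (auto simp: spaced_words_def PiE_iff extensional_def)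
      qed
    qed
    have "card ?T = (Suc m - s n + n - 1 - (\<Sum>i<n. s i)) choose n"
      using bij_betw_same_card[OF bij] IH by simp
    also have "Suc m - s n + n - 1 - (\<Sum>i<n. s i) = m + n - (\<Sum>i<Suc n. s i)"
      using assms(2)[of n] d by simp
    finally have T: "card ?T = (m + n - (\<Sum>i<Suc n. s i)) choose n" .
    have "card (spaced_words s (Suc n) (Suc m)) = card (spaced_words s (Suc n) m) + card ?T"
      by (subst split, rule card_Un_disjoint)
        (auto simp: finite_spaced_words, auto simp: spaced_words_def PiE_iff)
    also have "\<dots> = Suc (m + n - (\<Sum>i<Suc n. s i)) choose Suc n"
      using Suc.IH T by simp
    also have "Suc (m + n - (\<Sum>i<Suc n. s i)) = Suc m + Suc n - 1 - (\<Sum>i<Suc n. s i)"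
      using d by simp
    finally show ?case .
  qed
qed

lemma des_eq_sum: "des n \<pi> = (\<Sum>i<n. if 0 < i \<and> \<pi> (i + 1) < \<pi> i then 1 else 0)"
proof -
  have "(\<Sum>i<n. if 0 < i \<and> \<pi> (i + 1) < \<pi> i then 1 else 0) =
      card {i \<in> {..<n}. 0 < i \<and> \<pi> (i + 1) < \<pi> i}"
    by (simp add: sum.If_cases Collect_conj_eq lessThan_def)
  also have "{i \<in> {..<n}. 0 < i \<and> \<pi> (i + 1) < \<pi> i} = {i \<in> {1..n-1}. \<pi> i > \<pi> (i + 1)}"
    by auto
  finally show ?thesis by (simp add: des_def)
qed

text \<open>The order on pairs (letter, position) is transitive, so comparing neighbours
  suffices.\<close>

lemma sorts_iff_adjacent:
  "sorts n f \<sigma> \<longleftrightarrow> (\<forall>i\<in>{1..<n}. f (\<sigma> i) < f (\<sigma> (Suc i)) \<or>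
     f (\<sigma> i) = f (\<sigma> (Suc i)) \<and> \<sigma> i < \<sigma> (Suc i))"
proof
  assume adj: "\<forall>i\<in>{1..<n}. f (\<sigma> i) < f (\<sigma> (Suc i)) \<or>
     f (\<sigma> i) = f (\<sigma> (Suc i)) \<and> \<sigma> i < \<sigma> (Suc i)"
  have "f (\<sigma> i) < f (\<sigma> j) \<or> f (\<sigma> i) = f (\<sigma> j) \<and> \<sigma> i < \<sigma> j"
    if "i \<in> {1..n}" "j \<in> {1..n}" "i < j" for i j
  proof -
    have "Suc i \<le> j" using that(3) by simp
    then show ?thesis using that(2)
    proof (induction rule: dec_induct)
      case base
      then show ?case using adj that(1) by auto
    next
      case (step k)
      have "f (\<sigma> k) < f (\<sigma> (Suc k)) \<or> f (\<sigma> k) = f (\<sigma> (Suc k)) \<and> \<sigma> k < \<sigma> (Suc k)"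
        using adj step.prems step.hyps by auto
      then show ?case using step.IH step.prems step.hyps by auto
    qed
  qed
  then show "sorts n f \<sigma>" by (simp add: sorts_def)
qed (auto simp: sorts_def)

text \<open>Put \<open>c = f \<circ> \<sigma>\<close>. Equal neighbouring letters are allowed only
  where \<open>\<sigma>\<close> ascends, so \<open>c\<close> increases weakly, and strictly at the
  descents of \<open>\<sigma>\<close>.\<close>

lemma card_sorted_words:
  assumes \<sigma>: "\<sigma> permutes {1..n}"
  shows "card (sorted_words n m \<sigma>) = (m + n - 1 - des n \<sigma>) choose n"
proof -
  define s :: "nat \<Rightarrow> nat" where "s i = (if 0 < i \<and> \<sigma> (i + 1) < \<sigma> i then 1 else 0)" for i
  have step: "c i + s i \<le> c (Suc i) \<longleftrightarrow> c i < c (Suc i) \<or> c i = c (Suc i) \<and> \<sigma> i < \<sigma> (Suc i)"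
    if "i \<in> {1..<n}" for c i
    using that inj_eq[OF permutes_inj[OF \<sigma>], of i "Suc i"] by (auto simp: s_def)
  have comp: "f \<circ> \<rho> \<in> {1..n} \<rightarrow>\<^sub>E {..<m}"
    if "\<rho> permutes {1..n}" "f \<in> {1..n} \<rightarrow>\<^sub>E {..<m}" for f \<rho>
    using that permutes_in_image[OF that(1)]
    by (auto simp: PiE_iff extensional_def permutes_not_in)
  have "bij_betw (\<lambda>f. f \<circ> \<sigma>) (sorted_words n m \<sigma>) (spaced_words s n m)"
  proof (rule bij_betw_byWitness[where f' = "\<lambda>c. c \<circ> inv' \<sigma>"])
    show "(\<lambda>f. f \<circ> \<sigma>) ` sorted_words n m \<sigma> \<subseteq> spaced_words s n m"
      using comp[OF \<sigma>] step by (auto simp: sorted_words_def spaced_words_def sorts_iff_adjacent)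
    show "(\<lambda>c. c \<circ> inv' \<sigma>) ` spaced_words s n m \<subseteq> sorted_words n m \<sigma>"
    proof (intro image_subsetI)
      fix c assume c: "c \<in> spaced_words s n m"
      then have "c \<circ> inv' \<sigma> \<in> {1..n} \<rightarrow>\<^sub>E {..<m}"
        by (intro comp permutes_inv \<sigma>) (simp add: spaced_words_def)
      moreover have "sorts n (c \<circ> inv' \<sigma>) \<sigma>"
        using c step by (auto simp: spaced_words_def sorts_iff_adjacent permutes_inverses[OF \<sigma>])
      ultimately show "c \<circ> inv' \<sigma> \<in> sorted_words n m \<sigma>" by (simp add: sorted_words_def)
    qed
  qed (auto simp: fun_eq_iff permutes_inverses[OF \<sigma>])
  then have "card (sorted_words n m \<sigma>) = card (spaced_words s n m)" by (rule bij_betw_same_card)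
  also have "\<dots> = (m + n - 1 - (\<Sum>i<n. s i)) choose n"
    by (rule card_spaced_words) (auto simp: s_def)
  also have "(\<Sum>i<n. s i) = des n \<sigma>" by (simp add: des_eq_sum s_def)
  finally show ?thesis .
qed

section \<open>The polynomial coefficients\<close>

lemma poly_phi_coeff:
  "poly (phi_coeff n \<pi>) x = (x + of_nat n - 1 - of_nat (des n \<pi>)) gchoose n"
  by (simp add: phi_coeff_def poly_binom_poly algebra_simps)

lemma poly_psi_coeff:
  "poly (psi_coeff n \<pi>) x =
     x / of_nat n * ((x + of_nat n - 1 - of_nat (cdes n \<pi>)) gchoose (n - 1))"
  by (simp add: psi_coeff_def poly_binom_poly algebra_simps)

lemma des_le: "des n \<pi> \<le> n - 1"
proof -
  have "des n \<pi> \<le> card {1..n-1}" unfolding des_def by (rule card_mono) auto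
  then show ?thesis by simp
qed

lemma poly_phi_coeff_of_nat:
  assumes "n \<ge> 1" "\<pi> permutes {1..n}"
  shows "poly (phi_coeff n \<pi>) (of_nat a) = of_nat (card (sorted_words n a \<pi>))"
proof -
  \<comment> \<open>As \<open>des n \<pi> \<le> n - 1\<close>, the upper argument is a natural
    number even for \<open>a = 0\<close>, so the generalized binomial is an ordinary one.\<close>
  have "(of_nat a + of_nat n - 1 - of_nat (des n \<pi>) :: rat) = of_nat (a + n - 1 - des n \<pi>)"
    using des_le[of n \<pi>] assms(1) by (simp add: of_nat_diff)
  then show ?thesis
    by (simp add: poly_phi_coeff card_sorted_words[OF assms(2)] binomial_gbinomial)
qed

text \<open>This is \<open>\<phi>(a)\<phi>(b) = \<phi>(ab)\<close> at the coefficient of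
  \<open>\<pi>\<close>: the factorizations of \<open>\<pi>\<close> are \<open>\<sigma>\<close> times
  \<open>inv' \<sigma> \<circ> \<pi>\<close>.\<close>

lemma sum_phi_coeff_mult:
  assumes "n \<ge> 1" "\<pi> permutes {1..n}"
  shows "(\<Sum>\<sigma> | \<sigma> permutes {1..n}. poly (phi_coeff n \<sigma>) (of_nat a) *
            poly (phi_coeff n (inv' \<sigma> \<circ> \<pi>)) (of_nat b)) = poly (phi_coeff n \<pi>) (of_nat (a * b))"
proof -
  have "(\<Sum>\<sigma> | \<sigma> permutes {1..n}. poly (phi_coeff n \<sigma>) (of_nat a) *
            poly (phi_coeff n (inv' \<sigma> \<circ> \<pi>)) (of_nat b)) =
    (\<Sum>\<sigma> | \<sigma> permutes {1..n}. of_nat (card (sorted_words n a \<sigma>) *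
            card (sorted_words n b (inv' \<sigma> \<circ> \<pi>))))"
    by (intro sum.cong refl)
      (simp only: mem_Collect_eq of_nat_mult poly_phi_coeff_of_nat[OF assms(1)]
        permutes_compose[OF assms(2) permutes_inv])
  also have "\<dots> = of_nat (card (sorted_words n (a * b) \<pi>))"
    by (simp only: of_nat_sum[symmetric] sum_card_sorted_words[OF assms(2)])
  finally show ?thesis by (simp only: poly_phi_coeff_of_nat[OF assms])
qed

section \<open>Rotations\<close>

text \<open>The index is chosen so that position \<open>n\<close> goes to \<open>k\<close>: the word
  \<open>\<pi> \<circ> rotation n k\<close> is the cyclic word \<open>\<pi>\<close> cut just after
  position \<open>k\<close>.\<close>

definition rotation :: "nat \<Rightarrow> nat \<Rightarrow> nat \<Rightarrow> nat" where
  "rotation n k i = (if i \<in> {1..n} then (i + k - 1) mod n + 1 else i)"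

lemma rotation_permutes: "rotation n k permutes {1..n}"
proof (rule bij_imp_permutes)
  have "inj_on (rotation n k) {1..n}"
  proof (rule inj_onI)
    fix i j assume ij: "i \<in> {1..n}" "j \<in> {1..n}" "rotation n k i = rotation n k j"
    then have "((i - 1) + k) mod n = ((j - 1) + k) mod n" by (simp add: rotation_def)
    then have "(i - 1) mod n = (j - 1) mod n"
      using cong_add_rcancel_nat[of "i - 1" k "j - 1" n] by (simp add: cong_def)
    moreover have "i - 1 < n" "j - 1 < n" using ij by auto
    ultimately have "i - 1 = j - 1" by simp
    then show "i = j" using ij by auto
  qed
  moreover have "rotation n k ` {1..n} \<subseteq> {1..n}"
    by (auto simp: rotation_def Suc_le_eq)
  ultimately show "bij_betw (rotation n k) {1..n} {1..n}"
    by (simp add: bij_betw_def endo_inj_surj)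
qed (auto simp: rotation_def)

lemma rotation_Suc:
  assumes "i \<in> {1..n-1}"
  shows "rotation n k (i + 1) = (if rotation n k i = n then 1 else rotation n k i + 1)"
proof -
  have "rotation n k i = (i - 1 + k) mod n + 1" "rotation n k (i + 1) = Suc (i - 1 + k) mod n + 1"
    using assms by (auto simp: rotation_def)
  then show ?thesis by (simp add: mod_Suc)
qed

lemma rotation_last: "k \<in> {1..n} \<Longrightarrow> rotation n k n = k"
  using mod_add_self1[of n "k - 1"] by (auto simp: rotation_def)

text \<open>The neighbours in the rotated word are the cyclic neighbours in \<open>\<pi>\<close>,
  except for the pair that starts at \<open>k\<close>, where the cycle is cut.\<close>

lemma des_rotation:
  assumes "k \<in> {1..n}"
  shows "des n (\<pi> \<circ> rotation n k) =
    card ({i \<in> {1..n}. \<pi> i > \<pi> (if i = n then 1 else i + 1)} - {k})"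
proof -
  let ?r = "rotation n k"
  have inj: "inj ?r" by (rule permutes_inj[OF rotation_permutes])
  have "?r ` {1..n-1} = ?r ` ({1..n} - {n})" using assms by (intro arg_cong[where f="image ?r"]) auto
  also have "\<dots> = {1..n} - {k}"
    by (simp only: image_set_diff[OF inj] permutes_image[OF rotation_permutes]
        image_insert image_empty rotation_last[OF assms])
  finally have im: "?r ` {1..n-1} = {1..n} - {k}" .
  have "{i \<in> {1..n-1}. (\<pi> \<circ> ?r) i > (\<pi> \<circ> ?r) (i + 1)} =
      {i \<in> {1..n-1}. \<pi> (?r i) > \<pi> (if ?r i = n then 1 else ?r i + 1)}"
  proof (intro Collect_cong conj_cong refl)
    fix i assume "i \<in> {1..n-1}"
    from rotation_Suc[OF this]
    show "(\<pi> \<circ> ?r) i > (\<pi> \<circ> ?r) (i + 1) \<longleftrightarrow> \<pi> (?r i) > \<pi> (if ?r i = n then 1 else ?r i + 1)"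
      by (simp only: comp_apply)
  qed
  then have "?r ` {i \<in> {1..n-1}. (\<pi> \<circ> ?r) i > (\<pi> \<circ> ?r) (i + 1)} =
      {j \<in> ?r ` {1..n-1}. \<pi> j > \<pi> (if j = n then 1 else j + 1)}"
    by (simp only:) blast
  also have "\<dots> = {i \<in> {1..n}. \<pi> i > \<pi> (if i = n then 1 else i + 1)} - {k}"
    unfolding im by auto
  finally show ?thesis
    unfolding des_def using card_image[OF inj_on_subset[OF inj subset_UNIV]] by metis
qed

text \<open>
  Cutting the cyclic word \<open>\<pi>\<close> at a cyclic descent loses that descent, cutting it elsewhere
  loses none.
\<close>

lemma sum_phi_coeff_rotations:
  assumes "n \<ge> 1"
  shows "(\<Sum>k\<in>{1..n}. poly (phi_coeff n (\<pi> \<circ> rotation n k)) x) = of_nat n * poly (psi_coeff n \<pi>) x"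
proof -
  obtain m where n: "n = Suc m" using assms by (cases n) auto
  define D where "D = {i \<in> {1..n}. \<pi> i > \<pi> (if i = n then 1 else i + 1)}"
  define d where "d = card D"
  define N where "N = x + of_nat n - 1 - of_nat d"
  have D: "D \<subseteq> {1..n}" "finite D" by (auto simp: D_def)
  have cd: "cdes n \<pi> = d" by (simp add: cdes_def D_def d_def)
  have 1: "poly (phi_coeff n (\<pi> \<circ> rotation n k)) x = (N + 1) gchoose n" if "k \<in> D" for k
  proof -
    have "des n (\<pi> \<circ> rotation n k) = d - 1" "d > 0"
      using des_rotation[of k n \<pi>, folded D_def] that D by (auto simp: d_def card_gt_0_iff)
    then show ?thesis by (simp add: poly_phi_coeff N_def of_nat_diff algebra_simps)
  qed
  have 2: "poly (phi_coeff n (\<pi> \<circ> rotation n k)) x = N gchoose n" if "k \<in> {1..n} - D" for k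
    using des_rotation[of k n \<pi>, folded D_def] that
    by (simp add: d_def N_def poly_phi_coeff)
  have "(\<Sum>k\<in>{1..n}. poly (phi_coeff n (\<pi> \<circ> rotation n k)) x) =
      (\<Sum>k\<in>D. (N + 1) gchoose n) + (\<Sum>k\<in>{1..n} - D. N gchoose n)"
    using D by (subst sum.subset_diff[of D]) (simp_all add: 1 2)
  also have "\<dots> = of_nat d * ((N + 1) gchoose n) + (of_nat n - of_nat d) * (N gchoose n)"
    using D card_mono[OF _ D(1)] by (simp add: d_def card_Diff_subset of_nat_diff)
  \<comment> \<open>Pascal's rule splits \<open>(N + 1) gchoose n\<close>; the terms with
    \<open>of_nat d * (N gchoose n)\<close> cancel.\<close>
  also have "\<dots> = of_nat d * (N gchoose m) + of_nat (Suc m) * (N gchoose Suc m)"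
    by (simp only: n gbinomial_Suc_Suc) (simp add: algebra_simps)
  \<comment> \<open>Absorption turns \<open>of_nat (Suc m) * (N gchoose Suc m)\<close> into
    \<open>(N - of_nat m) * (N gchoose m)\<close>.\<close>
  also have "\<dots> = (N - of_nat m + of_nat d) * (N gchoose m)"
    using gbinomial_mult_1[of N m] by (simp add: algebra_simps)
  also have "N - of_nat m + of_nat d = x" by (simp add: N_def n)
  also have "x * (N gchoose m) = of_nat n * poly (psi_coeff n \<pi>) x"
    by (simp add: poly_psi_coeff cd[unfolded n] N_def n)
  finally show ?thesis .
qed

text \<open>After multiplication by \<open>n\<close>, each \<open>\<psi>\<close> coefficient is a
  sum of \<open>\<phi>\<close> coefficients over rotations. These act on the right, so the product
  rule for \<open>\<phi>\<close> applies to every \<open>\<pi> \<circ> rotation n k\<close>.\<close>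

lemma sum_phi_coeff_psi_coeff_of_nat:
  assumes "n \<ge> 1" "\<pi> permutes {1..n}"
  shows "(\<Sum>\<sigma> | \<sigma> permutes {1..n}. poly (phi_coeff n \<sigma>) (of_nat a) *
            poly (psi_coeff n (inv' \<sigma> \<circ> \<pi>)) (of_nat b)) = poly (psi_coeff n \<pi>) (of_nat (a * b))"
    (is "?L = ?R")
proof -
  have "of_nat n * ?L = (\<Sum>\<sigma> | \<sigma> permutes {1..n}. poly (phi_coeff n \<sigma>) (of_nat a) *
      (of_nat n * poly (psi_coeff n (inv' \<sigma> \<circ> \<pi>)) (of_nat b)))"
    by (simp add: sum_distrib_left algebra_simps)
  also have "\<dots> = (\<Sum>\<sigma> | \<sigma> permutes {1..n}. \<Sum>k\<in>{1..n}. poly (phi_coeff n \<sigma>) (of_nat a) *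
      poly (phi_coeff n (inv' \<sigma> \<circ> (\<pi> \<circ> rotation n k))) (of_nat b))"
    by (simp only: sum_phi_coeff_rotations[OF assms(1), symmetric] sum_distrib_left o_assoc)
  also have "\<dots> = (\<Sum>k\<in>{1..n}. \<Sum>\<sigma> | \<sigma> permutes {1..n}. poly (phi_coeff n \<sigma>) (of_nat a) *
      poly (phi_coeff n (inv' \<sigma> \<circ> (\<pi> \<circ> rotation n k))) (of_nat b))"
    by (rule sum.swap)
  also have "\<dots> = (\<Sum>k\<in>{1..n}. poly (phi_coeff n (\<pi> \<circ> rotation n k)) (of_nat (a * b)))"
    by (intro sum.cong refl sum_phi_coeff_mult assms permutes_compose rotation_permutes)
  also have "\<dots> = of_nat n * ?R" by (rule sum_phi_coeff_rotations[OF assms(1)])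
  finally show ?thesis using assms(1) by simp
qed

section \<open>From values at natural numbers to coefficients\<close>

lemma poly_eqI_of_nat:
  fixes p q :: "'a :: {idom, ring_char_0} poly"
  assumes "\<And>a. poly p (of_nat a) = poly q (of_nat a)"
  shows "p = q"
proof (rule ccontr)
  assume "p \<noteq> q"
  then have "finite {x. poly (p - q) x = 0}" by (intro poly_roots_finite) simp
  moreover have "range of_nat \<subseteq> {x. poly (p - q) x = 0}" using assms by auto
  ultimately have "finite (range (of_nat :: nat \<Rightarrow> 'a))" by (rule finite_subset[rotated])
  then show False by (simp add: range_inj_infinite inj_of_nat)
qed

text \<open>The variables are freed one at a time: for fixed \<open>a\<close> both sides are
  polynomials in \<open>b\<close>, and their coefficients are then polynomials in \<open>a\<close>.
  The right side \<open>r(xy)\<close> has only diagonal terms.\<close>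

lemma coeff_sum_mult_of_nat:
  fixes p q :: "'i \<Rightarrow> 'a :: {idom, ring_char_0} poly"
  assumes "\<And>a b. (\<Sum>s\<in>S. poly (p s) (of_nat a) * poly (q s) (of_nat b)) = poly r (of_nat (a * b))"
  shows "(\<Sum>s\<in>S. poly.coeff (p s) i * poly.coeff (q s) j) = (if i = j then poly.coeff r i else 0)"
proof -
  have *: "(\<Sum>s\<in>S. poly (p s) (of_nat a) * poly.coeff (q s) j) = of_nat a ^ j * poly.coeff r j" for a
  proof -
    \<comment> \<open>The composition is \<open>r(ay)\<close> as a polynomial in \<open>y\<close>;
      its \<open>j\<close>-th coefficient carries the factor \<open>a ^ j\<close>.\<close>
    have "(\<Sum>s\<in>S. smult (poly (p s) (of_nat a)) (q s)) = pcompose r [:0, of_nat a:]"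
      by (rule poly_eqI_of_nat) (use assms[of a] in \<open>simp add: poly_sum poly_pcompose mult.commute\<close>)
    then have "poly.coeff (\<Sum>s\<in>S. smult (poly (p s) (of_nat a)) (q s)) j =
        poly.coeff (pcompose r [:0, of_nat a:]) j" by simp
    then show ?thesis by (simp add: coeff_sum coeff_pcompose_linear)
  qed
  have "(\<Sum>s\<in>S. smult (poly.coeff (q s) j) (p s)) = Polynomial.monom (poly.coeff r j) j"
    by (rule poly_eqI_of_nat) (use * in \<open>simp add: poly_sum poly_monom mult.commute\<close>)
  then have "poly.coeff (\<Sum>s\<in>S. smult (poly.coeff (q s) j) (p s)) i =
      poly.coeff (Polynomial.monom (poly.coeff r j) j) i" by simp
  then show ?thesis by (simp add: coeff_sum mult.commute split: if_splits)
qed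

section \<open>Coefficients of the substituted polynomials\<close>

text \<open>Lets the coefficient laws of \<open>UP\<close> be used on polynomials taken as plain
  functions of the exponent.\<close>

lemma uni_coeff:
  "p \<in> carrier (uni_poly_ring n) \<Longrightarrow> up_ring.coeff (uni_poly_ring n) p k = p k"
  by (simp add: UP_def)

lemma biv_coeff:
  "p \<in> carrier (biv_poly_ring n) \<Longrightarrow> up_ring.coeff (biv_poly_ring n) p k = p k"
  by (simp add: UP_def)

lemma sym_algebra_zero: "\<zero>\<^bsub>sym_algebra n\<^esub> = (\<lambda>\<tau>. 0)"
  by (simp add: sym_algebra_def group_algebra_simps)

lemma sym_algebra_finsum:
  assumes "finite I" "f \<in> I \<rightarrow> carrier (sym_algebra n)"
  shows "finsum (sym_algebra n) f I \<tau> = (\<Sum>i\<in>I. f i \<tau>)"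
proof -
  interpret A: ring "sym_algebra n" by (rule ring_sym_algebra)
  show ?thesis
    using assms
  proof (induction I rule: finite_induct)
    case empty
    then show ?case by (simp add: sym_algebra_zero)
  next
    case (insert i I)
    then have "finsum (sym_algebra n) f (insert i I) = f i \<oplus>\<^bsub>sym_algebra n\<^esub> finsum (sym_algebra n) f I"
      by (intro A.finsum_insert) auto
    then show ?case using insert by (auto simp: sym_algebra_def group_algebra_simps(5))
  qed
qed

lemma sym_algebra_mult:
  assumes "\<pi> permutes {1..n}"
  shows "(f \<otimes>\<^bsub>sym_algebra n\<^esub> h) \<pi> = (\<Sum>\<sigma> | \<sigma> permutes {1..n}. f \<sigma> * h (inv' \<sigma> \<circ> \<pi>))"
proof -
  interpret G: group "sym_group n" by (rule sym_group_is_group)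
  have "inv\<^bsub>sym_group n\<^esub> \<sigma> = inv' \<sigma>" if "\<sigma> permutes {1..n}" for \<sigma>
    by (rule G.inv_equality)
      (use that in \<open>auto simp: sym_group_mult sym_group_one sym_group_carrier permutes_inv permutes_inv_o\<close>)
  then show ?thesis
    using assms by (simp add: sym_algebra_def G.group_algebra_mult_apply sym_group_carrier)
      (auto simp: sym_group_def intro!: sum.cong)
qed

lemma sym_algebra_mult_outside:
  "\<not> \<pi> permutes {1..n} \<Longrightarrow> (f \<otimes>\<^bsub>sym_algebra n\<^esub> h) \<pi> = 0"
  unfolding sym_algebra_def
  by (rule group_algebra_mult_outside[OF sym_group_is_group]) (simp add: sym_group_carrier)

section \<open>Bivariate monomials and substitution\<close>

definition biv_monom :: "nat \<Rightarrow> ((nat \<Rightarrow> nat) \<Rightarrow> rat) \<Rightarrow> nat \<Rightarrow> nat \<Rightarrow> nat \<Rightarrow> nat \<Rightarrow> (nat \<Rightarrow> nat) \<Rightarrow> rat" where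
  "biv_monom n a k l = up_ring.monom (biv_poly_ring n) (up_ring.monom (uni_poly_ring n) a k) l"

lemma biv_monom_closed:
  assumes "a \<in> carrier (sym_algebra n)"
  shows "biv_monom n a k l \<in> carrier (biv_poly_ring n)"
proof -
  interpret A: UP_ring "sym_algebra n" "uni_poly_ring n"
    by (intro UP_ring.intro ring_sym_algebra)
  interpret U: UP_ring "uni_poly_ring n" "biv_poly_ring n"
    by (intro UP_ring.intro ring_uni_poly_ring)
  show ?thesis using assms by (simp add: biv_monom_def)
qed

text \<open>The outer exponent, that of \<open>y\<close>, is the first argument, so
  \<open>j i\<close> addresses the coefficient of \<open>x^i y^j\<close>.\<close>

lemma biv_monom_apply:
  assumes "a \<in> carrier (sym_algebra n)"
  shows "biv_monom n a k l j i \<tau> = (if i = k \<and> j = l then a \<tau> else 0)"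
proof -
  interpret A: UP_ring "sym_algebra n" "uni_poly_ring n"
    by (intro UP_ring.intro ring_sym_algebra)
  have "up_ring.monom (uni_poly_ring n) a k \<in> carrier (uni_poly_ring n)" using assms by simp
  then show ?thesis using assms
    by (simp add: biv_monom_def UP_def sym_algebra_zero)
qed

lemma biv_monom_mult:
  assumes "a \<in> carrier (sym_algebra n)" "b \<in> carrier (sym_algebra n)"
  shows "biv_monom n a k l \<otimes>\<^bsub>biv_poly_ring n\<^esub> biv_monom n b k' l' =
    biv_monom n (a \<otimes>\<^bsub>sym_algebra n\<^esub> b) (k + k') (l + l')"
proof -
  interpret A: UP_ring "sym_algebra n" "uni_poly_ring n"
    by (intro UP_ring.intro ring_sym_algebra)
  interpret U: UP_ring "uni_poly_ring n" "biv_poly_ring n"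
    by (intro UP_ring.intro ring_uni_poly_ring)
  show ?thesis using assms by (simp add: biv_monom_def)
qed

lemma biv_monom_one_pow:
  "biv_monom n \<one>\<^bsub>sym_algebra n\<^esub> k l [^]\<^bsub>biv_poly_ring n\<^esub> (e::nat) =
     biv_monom n \<one>\<^bsub>sym_algebra n\<^esub> (k * e) (l * e)"
proof (induction e)
  interpret A: UP_ring "sym_algebra n" "uni_poly_ring n"
    by (intro UP_ring.intro ring_sym_algebra)
  interpret U: UP_ring "uni_poly_ring n" "biv_poly_ring n"
    by (intro UP_ring.intro ring_uni_poly_ring)
  case 0
  show ?case by (simp add: biv_monom_def)
next
  interpret A: ring "sym_algebra n" by (rule ring_sym_algebra)
  interpret B: ring "biv_poly_ring n" by (rule ring_biv_poly_ring)
  case (Suc e)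
  then show ?case by (simp add: biv_monom_mult add.commute)
qed

text \<open>Substituting a monomial \<open>x^k y^l\<close> treats \<open>x\<close>, \<open>y\<close>
  and \<open>xy\<close> at once. Each \<open>p e\<close> contributes the single monomial with
  exponents \<open>k * e\<close> and \<open>l * e\<close>.\<close>

lemma subst_biv_apply:
  assumes p: "p \<in> carrier (uni_poly_ring n)"
  shows "subst_biv n p (biv_monom n \<one>\<^bsub>sym_algebra n\<^esub> k l) j i \<tau> =
    (\<Sum>e\<le>deg (sym_algebra n) p. if i = k * e \<and> j = l * e then p e \<tau> else 0)"
    and subst_biv_closed:
    "subst_biv n p (biv_monom n \<one>\<^bsub>sym_algebra n\<^esub> k l) \<in> carrier (biv_poly_ring n)"
proof -
  interpret A: UP_ring "sym_algebra n" "uni_poly_ring n"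
    by (intro UP_ring.intro ring_sym_algebra)
  interpret U: UP_ring "uni_poly_ring n" "biv_poly_ring n"
    by (intro UP_ring.intro ring_uni_poly_ring)
  let ?E = "{..deg (sym_algebra n) p}"
  let ?m = "\<lambda>e. biv_monom n (p e) (k * e) (l * e)"
  have pc: "p e \<in> carrier (sym_algebra n)" for e
    using A.coeff_closed[OF p] by (simp add: uni_coeff[OF p])
  have m: "?m \<in> ?E \<rightarrow> carrier (biv_poly_ring n)" using pc by (simp add: biv_monom_closed)
  have "subst_biv n p (biv_monom n \<one>\<^bsub>sym_algebra n\<^esub> k l) =
    (\<Oplus>\<^bsub>biv_poly_ring n\<^esub>e\<in>?E. biv_monom n (p e) 0 0 \<otimes>\<^bsub>biv_poly_ring n\<^esub>
       biv_monom n \<one>\<^bsub>sym_algebra n\<^esub> (k * e) (l * e))"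
    unfolding subst_biv_def A.eval_on_carrier[OF p]
    by (simp only: uni_coeff[OF p] biv_monom_one_pow biv_const_def biv_monom_def[symmetric])
  also have "\<dots> = (\<Oplus>\<^bsub>biv_poly_ring n\<^esub>e\<in>?E. ?m e)"
    by (simp add: biv_monom_mult pc)
  finally have eq: "subst_biv n p (biv_monom n \<one>\<^bsub>sym_algebra n\<^esub> k l) = finsum (biv_poly_ring n) ?m ?E" .
  show cl: "subst_biv n p (biv_monom n \<one>\<^bsub>sym_algebra n\<^esub> k l) \<in> carrier (biv_poly_ring n)"
    unfolding eq by (rule U.P.finsum_closed[OF m])
  have mc: "?m e j \<in> carrier (uni_poly_ring n)" for e
    using U.coeff_closed[OF biv_monom_closed[OF pc], of e "k * e" "l * e" j]
    by (simp only: biv_coeff[OF biv_monom_closed[OF pc]])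
  then have mj: "(\<lambda>e. ?m e j) \<in> ?E \<rightarrow> carrier (uni_poly_ring n)" by simp
  have "?m e j i \<in> carrier (sym_algebra n)" for e
    using A.coeff_closed[OF mc] by (simp only: uni_coeff[OF mc])
  then have mji: "(\<lambda>e. ?m e j i) \<in> ?E \<rightarrow> carrier (sym_algebra n)" by simp
  \<comment> \<open>Evaluation passes through the sum in three layers: the exponent of
    \<open>y\<close>, the exponent of \<open>x\<close>, the permutation.\<close>
  have "subst_biv n p (biv_monom n \<one>\<^bsub>sym_algebra n\<^esub> k l) j = finsum (uni_poly_ring n) (\<lambda>e. ?m e j) ?E"
    using U.coeff_finsum[OF _ m, of j] cl eq by (simp add: biv_coeff biv_monom_closed pc)
  moreover have "finsum (uni_poly_ring n) (\<lambda>e. ?m e j) ?E i = finsum (sym_algebra n) (\<lambda>e. ?m e j i) ?E"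
    using A.coeff_finsum[OF _ mj, of i] A.P.finsum_closed[OF mj]
    by (simp only: uni_coeff uni_coeff[OF mc] finite_atMost)
  moreover have "finsum (sym_algebra n) (\<lambda>e. ?m e j i) ?E \<tau> = (\<Sum>e\<in>?E. ?m e j i \<tau>)"
    by (rule sym_algebra_finsum[OF _ mji]) simp
  ultimately show "subst_biv n p (biv_monom n \<one>\<^bsub>sym_algebra n\<^esub> k l) j i \<tau> =
    (\<Sum>e\<le>deg (sym_algebra n) p. if i = k * e \<and> j = l * e then p e \<tau> else 0)"
    by (simp add: biv_monom_apply pc)
qed

text \<open>Needed because evaluation sums only up to the degree, while the coefficient formulas
  below hold for all exponents.\<close>

lemma uni_above_deg:
  assumes "p \<in> carrier (uni_poly_ring n)" "deg (sym_algebra n) p < i"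
  shows "p i \<tau> = 0"
proof -
  interpret A: UP_ring "sym_algebra n" "uni_poly_ring n"
    by (intro UP_ring.intro ring_sym_algebra)
  show ?thesis using A.deg_aboveD[OF assms(2,1)] by (simp add: uni_coeff assms sym_algebra_zero)
qed

lemma var_x_eq: "var_x n = biv_monom n \<one>\<^bsub>sym_algebra n\<^esub> 1 0"
  by (simp add: var_x_def biv_monom_def)

lemma var_y_eq: "var_y n = biv_monom n \<one>\<^bsub>sym_algebra n\<^esub> 0 1"
proof -
  interpret A: UP_ring "sym_algebra n" "uni_poly_ring n"
    by (intro UP_ring.intro ring_sym_algebra)
  show ?thesis by (simp add: var_y_def biv_monom_def)
qed

lemma var_x_mult_var_y:
  "var_x n \<otimes>\<^bsub>biv_poly_ring n\<^esub> var_y n = biv_monom n \<one>\<^bsub>sym_algebra n\<^esub> 1 1"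
proof -
  interpret A: ring "sym_algebra n" by (rule ring_sym_algebra)
  show ?thesis by (simp add: var_x_eq var_y_eq biv_monom_mult)
qed

lemma subst_var_x:
  assumes "p \<in> carrier (uni_poly_ring n)"
  shows "subst_biv n p (var_x n) j i \<tau> = (if j = 0 then p i \<tau> else 0)"
  using uni_above_deg[OF assms, of i \<tau>]
  by (cases "j = 0") (auto simp: var_x_eq subst_biv_apply[OF assms])

lemma subst_var_y:
  assumes "p \<in> carrier (uni_poly_ring n)"
  shows "subst_biv n p (var_y n) j i \<tau> = (if i = 0 then p j \<tau> else 0)"
  using uni_above_deg[OF assms, of j \<tau>]
  by (cases "i = 0") (auto simp: var_y_eq subst_biv_apply[OF assms])

lemma subst_var_xy:
  assumes "p \<in> carrier (uni_poly_ring n)"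
  shows "subst_biv n p (var_x n \<otimes>\<^bsub>biv_poly_ring n\<^esub> var_y n) j i \<tau> = (if i = j then p i \<tau> else 0)"
  using uni_above_deg[OF assms, of i \<tau>]
  by (cases "i = j") (auto simp: var_x_mult_var_y subst_biv_apply[OF assms] intro!: sum.neutral)

text \<open>The first factor is constant in \<open>y\<close> and the second is constant in
  \<open>x\<close>, so both Cauchy products collapse to one term; the order of the group algebra
  factors is kept.\<close>

lemma subst_var_x_mult_subst_var_y:
  assumes p: "p \<in> carrier (uni_poly_ring n)" and q: "q \<in> carrier (uni_poly_ring n)"
  shows "(subst_biv n p (var_x n) \<otimes>\<^bsub>biv_poly_ring n\<^esub> subst_biv n q (var_y n)) j i =
    p i \<otimes>\<^bsub>sym_algebra n\<^esub> q j"
proof -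
  interpret A: UP_ring "sym_algebra n" "uni_poly_ring n"
    by (intro UP_ring.intro ring_sym_algebra)
  interpret U: UP_ring "uni_poly_ring n" "biv_poly_ring n"
    by (intro UP_ring.intro ring_uni_poly_ring)
  let ?X = "subst_biv n p (var_x n)" and ?Y = "subst_biv n q (var_y n)"
  have X: "?X \<in> carrier (biv_poly_ring n)" and Y: "?Y \<in> carrier (biv_poly_ring n)"
    unfolding var_x_eq var_y_eq by (intro subst_biv_closed p q)+
  have Xc: "?X k \<in> carrier (uni_poly_ring n)" and Yc: "?Y k \<in> carrier (uni_poly_ring n)" for k
    using U.coeff_closed[OF X, of k] U.coeff_closed[OF Y, of k] by (simp_all add: biv_coeff X Y)
  have pc: "p k \<in> carrier (sym_algebra n)" and qc: "q k \<in> carrier (sym_algebra n)" for k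
    using A.coeff_closed[OF p, of k] A.coeff_closed[OF q, of k] by (simp_all add: uni_coeff p q)
  have Xp: "?X 0 = p" by (simp add: fun_eq_iff subst_var_x[OF p])
  have X0: "?X k = \<zero>\<^bsub>uni_poly_ring n\<^esub>" if "k \<noteq> 0" for k
    using that by (simp add: fun_eq_iff subst_var_x[OF p] UP_def sym_algebra_zero)
  have Yq: "?Y j 0 = q j" by (simp add: fun_eq_iff subst_var_y[OF q])
  have Y0: "?Y j k = \<zero>\<^bsub>sym_algebra n\<^esub>" if "k \<noteq> 0" for k
    using that by (simp add: fun_eq_iff subst_var_y[OF q] sym_algebra_zero)
  have "(?X \<otimes>\<^bsub>biv_poly_ring n\<^esub> ?Y) j =
      (\<Oplus>\<^bsub>uni_poly_ring n\<^esub>k\<in>{..j}. ?X k \<otimes>\<^bsub>uni_poly_ring n\<^esub> ?Y (j - k))"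
    using U.coeff_mult[OF X Y, of j] by (simp add: biv_coeff X Y)
  \<comment> \<open>Only \<open>k = 0\<close> survives here, and only \<open>k = i\<close> in the
    inner product below.\<close>
  also have "\<dots> = (\<Oplus>\<^bsub>uni_poly_ring n\<^esub>k\<in>{..j}. if 0 = k then p \<otimes>\<^bsub>uni_poly_ring n\<^esub> ?Y (j - k) else \<zero>\<^bsub>uni_poly_ring n\<^esub>)"
    by (rule A.P.finsum_cong') (auto simp: Xp X0 Yc p)
  also have "\<dots> = p \<otimes>\<^bsub>uni_poly_ring n\<^esub> ?Y j"
    by (subst A.P.finsum_singleton) (auto simp: Yc p)
  finally have "(?X \<otimes>\<^bsub>biv_poly_ring n\<^esub> ?Y) j i =
      (\<Oplus>\<^bsub>sym_algebra n\<^esub>k\<in>{..i}. p k \<otimes>\<^bsub>sym_algebra n\<^esub> ?Y j (i - k))"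
    using A.coeff_mult[OF p Yc[of j], of i] by (simp add: uni_coeff p Yc)
  also have "\<dots> = (\<Oplus>\<^bsub>sym_algebra n\<^esub>k\<in>{..i}. if i = k then p k \<otimes>\<^bsub>sym_algebra n\<^esub> q j else \<zero>\<^bsub>sym_algebra n\<^esub>)"
    by (rule A.R.finsum_cong') (auto simp: Yq Y0 pc qc)
  also have "\<dots> = p i \<otimes>\<^bsub>sym_algebra n\<^esub> q j"
    by (subst A.R.finsum_singleton) (auto simp: pc qc)
  finally show ?thesis .
qed

theorem theorem1p5p7:
  fixes n :: nat
  assumes "n \<ge> 1"
  shows "subst_biv n (phi n) (var_x n) \<otimes>\<^bsub>biv_poly_ring n\<^esub> subst_biv n (psi n) (var_y n)
       = subst_biv n (psi n) (var_x n \<otimes>\<^bsub>biv_poly_ring n\<^esub> var_y n)"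
proof (intro ext)
  fix j i \<pi>
  \<comment> \<open>Both sides are compared at the coefficient of \<open>x^i y^j\<close> and
    \<open>\<pi>\<close>; \<open>\<psi>(xy)\<close> contributes only for
    \<open>i = j\<close>.\<close>
  have "(phi n i \<otimes>\<^bsub>sym_algebra n\<^esub> psi n j) \<pi> = (if i = j then psi n i \<pi> else 0)"
  proof (cases "\<pi> permutes {1..n}")
    case True
    have "(phi n i \<otimes>\<^bsub>sym_algebra n\<^esub> psi n j) \<pi> =
        (\<Sum>\<sigma> | \<sigma> permutes {1..n}. poly.coeff (phi_coeff n \<sigma>) i * poly.coeff (psi_coeff n (inv' \<sigma> \<circ> \<pi>)) j)"
      unfolding sym_algebra_mult[OF True]
      by (intro sum.cong refl)
        (simp only: mem_Collect_eq phi_apply psi_apply permutes_compose[OF True permutes_inv] if_True)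
    also have "\<dots> = (if i = j then poly.coeff (psi_coeff n \<pi>) i else 0)"
      by (rule coeff_sum_mult_of_nat) (rule sum_phi_coeff_psi_coeff_of_nat[OF assms True])
    finally show ?thesis using True by (simp add: psi_apply)
  next
    case False
    then show ?thesis by (simp add: sym_algebra_mult_outside psi_apply)
  qed
  then show "(subst_biv n (phi n) (var_x n) \<otimes>\<^bsub>biv_poly_ring n\<^esub> subst_biv n (psi n) (var_y n)) j i \<pi> =
      subst_biv n (psi n) (var_x n \<otimes>\<^bsub>biv_poly_ring n\<^esub> var_y n) j i \<pi>"
    by (simp only: subst_var_x_mult_subst_var_y[OF phi_closed psi_closed] subst_var_xy[OF psi_closed])
qed

end
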